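(* Let $f(\mathcal{M},\mathbf{D})=f_{\mathsf{SP}}(\mathcal{M},\mathbf{D})$ be the bias/unfairness (statistical parity) of the binary classifier $\mathcal{M}$ on the dataset $\mathbf{D}$, and for each non-empty $\mathbf{S}\subseteq[m]$ let $w_{\mathbf{S}}$ be the Fairness Influence Function (FIF) of the subset of features $\mathbf{Z}_{\mathbf{S}}$. Assume $\Pr[\widehat{Y}=0\mid\mathbf{A}=\mathbf{a}_{\max}]\neq 0$ and $\Pr[\widehat{Y}=0\mid\mathbf{A}=\mathbf{a}_{\min}]\neq 0$. Then the following hold. (a) (Decomposability) The sum of the FIFs of all non-empty subsets of features equals the bias of the classifier: \[ \sum_{\emptyset\neq\mathbf{S}\subseteq[m]}w_{\mathbf{S}}=f(\mathcal{M},\mathbf{D}). \] (b) (Symmetry) Two features $Z_i$ and $Z_j$ ($i\neq j$ in $[m]$) are equivalent based on FIF, meaning that the sums of their individual influences and of their intersectional influences with all other features are the same, \[ \sum_{\mathbf{S}''\subseteq[m]\setminus\{i,j\}}w_{\mathbf{S}''\cup\{i\}}=\sum_{\mathbf{S}''\subseteq[m]\setminus\{i,j\}}w_{\mathbf{S}''\cup\{j\}}, \] (where $\mathbf{S}''=\emptyset$ is included in both sums), if \[ \sum_{\emptyset\neq\mathbf{S}'\subseteq\mathbf{S}\cup\{i\}}w_{\mathbf{S}'}=\sum_{\emptyset\neq\mathbf{S}'\subseteq\mathbf{S}\cup\{j\}}w_{\mathbf{S}'} \] for every non-empty subset $\mathbf{S}$ of $[m]$ containing neither $i$ nor $j$.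 (c) (Null) A feature $Z_i$ ($i\in[m]$) is a dummy or neutral feature, meaning that the sum of its individual influence and its intersectional influences with all other features is zero, \[ \sum_{\mathbf{S}''\subseteq[m]\setminus\{i\}}w_{\mathbf{S}''\cup\{i\}}=0, \] (where $\mathbf{S}''=\emptyset$ is included in the sum), if \[ \sum_{\emptyset\neq\mathbf{S}'\subseteq\mathbf{S}\cup\{i\}}w_{\mathbf{S}'}=\sum_{\emptyset\neq\mathbf{S}'\subseteq\mathbf{S}}w_{\mathbf{S}'} \] for every non-empty subset $\mathbf{S}$ of $[m]$ that does not contain $i$.
   Context: A data point has a random feature vector $\mathbf{Z}=(\mathbf{X},\mathbf{A})=(Z_1,\dots,Z_m)$, where $\mathbf{X}$ consists of $m_1$ non-sensitive (real-valued) features, $\mathbf{A}$ consists of $m_2$ sensitive (categorical) features, and $m=m_1+m_2$. Write $[m]=\{1,\dots,m\}$ and $\mathbf{Z}_{\mathbf{S}}=\{Z_i: i\in\mathbf{S}\}$ for $\mathbf{S}\subseteq[m]$. $\mathbf{D}$ denotes the dataset, a finite set of data points generated from an underlying distribution, and probabilities are with respect to the distribution of the data points. The values $\mathbf{a}$ of $\mathbf{A}$ are called sensitive groups. A binary classifier is a function $\mathcal{M}$ of $(\mathbf{X},\mathbf{A})$ with values in $\{0,1\}$, and $\widehat{Y}=\mathcal{M}(\mathbf{X},\mathbf{A})\in\{0,1\}$ is the predicted class. The statistical parity is $f_{\mathsf{SP}}(\mathcal{M},\mathbf{D})=\max_{\mathbf{a}}\Pr[\widehat{Y}=1\mid\mathbf{A}=\mathbf{a}]-\min_{\mathbf{a}}\Pr[\widehat{Y}=1\mid\mathbf{A}=\mathbf{a}]$.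 The groups $\mathbf{a}_{\max}$ and $\mathbf{a}_{\min}$ are a maximizer and a minimizer, respectively, of $\mathbf{a}\mapsto\Pr[\widehat{Y}=1\mid\mathbf{A}=\mathbf{a}]$ (the most and the least favored groups). For a sensitive group $\mathbf{a}$ and a non-empty $\mathbf{S}\subseteq[m]$, the decomposed variance is defined recursively by \[ V_{\mathbf{a},\mathbf{S}}=\mathsf{Var}_{\mathbf{Z}_{\mathbf{S}}}\big[\mathbb{E}_{\mathbf{Z}\setminus\mathbf{Z}_{\mathbf{S}}}[\mathbf{1}[\widehat{Y}=1]\mid\mathbf{A}=\mathbf{a},\mathbf{Z}_{\mathbf{S}}]\big]-\sum_{\emptyset\neq\mathbf{S}'\subsetneq\mathbf{S}}V_{\mathbf{a},\mathbf{S}'}. \] Here the first term is the variance, under the conditional distribution given $\mathbf{A}=\mathbf{a}$, of the conditional expectation of $\mathbf{1}[\widehat{Y}=1]$ given $\mathbf{Z}_{\mathbf{S}}$ (also computed under the conditional distribution given $\mathbf{A}=\mathbf{a}$). The Fairness Influence Function of $\mathbf{Z}_{\mathbf{S}}$ is \[ w_{\mathbf{S}}=\frac{V_{\mathbf{a}_{\max},\mathbf{S}}}{\Pr[\widehat{Y}=0\mid\mathbf{A}=\mathbf{a}_{\max}]}-\frac{V_{\mathbf{a}_{\min},\mathbf{S}}}{\Pr[\widehat{Y}=0\mid\mathbf{A}=\mathbf{a}_{\min}]}. \] It is called an individual influence when $|\mathbf{S}|=1$ and an intersectional influence when $|\mathbf{S}|>1$.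
   Formalization: Part (b) is proved except when there is exactly one non-sensitive and one sensitive feature (m1 = m2 = 1); there its condition is vacuous and the claim fails, e.g. for X, A independent uniform on {0,1} and Ŷ = XA, where the influences are 1/2 and 0. *)

theory Defs
  imports "HOL-Probability.Probability"
begin

text \<open>
  A data point is a pair \<open>(x, a)\<close> of non-sensitive features \<open>x 1, ..., x m1\<close> and sensitive
  features \<open>a 1, ..., a m2\<close>. The categories of all sensitive features are coded in one common
  finite type \<open>'c\<close>; a feature that uses only some of the codes just never takes the others.
\<close>

type_synonym 'c point = "(nat \<Rightarrow> real) \<times> (nat \<Rightarrow> 'c)"

definition feature_space :: "nat \<Rightarrow> nat \<Rightarrow> ('c :: finite) point measure" where
  "feature_space m1 m2 =
     (\<Pi>\<^sub>M i\<in>{1..m1}. borel) \<Otimes>\<^sub>M (\<Pi>\<^sub>M j\<in>{1..m2}. count_space UNIV)"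

text \<open>
  The features are numbered \<open>Z 1, ..., Z (m1 + m2)\<close>, where \<open>Z i\<close> is \<open>x i\<close> for \<open>i \<le> m1\<close> and
  \<open>a (i - m1)\<close> for \<open>i > m1\<close>. As their values have different types, conditioning on the
  \<open>Z i\<close> with \<open>i \<in> S\<close> is expressed by the sigma-algebra that they generate.
\<close>

definition feature_algebra :: "nat \<Rightarrow> nat \<Rightarrow> nat \<Rightarrow> ('c :: finite) point measure" where
  "feature_algebra m1 m2 i =
     (if i \<le> m1
      then vimage_algebra (space (feature_space m1 m2)) (\<lambda>z. fst z i) borel
      else vimage_algebra (space (feature_space m1 m2)) (\<lambda>z. snd z (i - m1)) (count_space UNIV))"

definition features_algebra :: "nat \<Rightarrow> nat \<Rightarrow> nat set \<Rightarrow> ('c :: finite) point measure" where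
  "features_algebra m1 m2 S =
     sigma (space (feature_space m1 m2)) (\<Union>i\<in>S. sets (feature_algebra m1 m2 i))"

text \<open>
  Below, \<open>D\<close> is the distribution of the data points. Conditioning on \<open>A = a\<close> makes sense only
  for groups of positive probability, so only these count as sensitive groups.
\<close>

definition sensitive_groups :: "'c point measure \<Rightarrow> (nat \<Rightarrow> 'c) set" where
  "sensitive_groups D = {a. \<P>(z in D. snd z = a) > 0}"

definition group_prob :: "('c point \<Rightarrow> nat) \<Rightarrow> 'c point measure \<Rightarrow> nat \<Rightarrow> (nat \<Rightarrow> 'c) \<Rightarrow> real" where
  "group_prob \<M> D y a = \<P>(z in D. \<M> z = y \<bar> snd z = a)"

definition statistical_parity :: "('c point \<Rightarrow> nat) \<Rightarrow> 'c point measure \<Rightarrow> real" where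
  "statistical_parity \<M> D =
     Max (group_prob \<M> D 1 ` sensitive_groups D) - Min (group_prob \<M> D 1 ` sensitive_groups D)"

text \<open>For \<open>a\<close> in \<open>sensitive_groups D\<close>, the conditional distribution given \<open>A = a\<close>.\<close>

definition group_law :: "'c point measure \<Rightarrow> (nat \<Rightarrow> 'c) \<Rightarrow> 'c point measure" where
  "group_law D a = uniform_measure D {z \<in> space D. snd z = a}"

definition explained_variance ::
  "nat \<Rightarrow> nat \<Rightarrow> ('c :: finite point \<Rightarrow> nat) \<Rightarrow> 'c point measure \<Rightarrow> (nat \<Rightarrow> 'c) \<Rightarrow> nat set \<Rightarrow> real" where
  "explained_variance m1 m2 \<M> D a S =
     prob_space.variance (group_law D a)
       (real_cond_exp (group_law D a) (features_algebra m1 m2 S) (indicator {z. \<M> z = 1}))"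

text \<open>The guard \<open>finite S\<close> only serves termination; all feature sets of interest are finite.\<close>

function decomposed_variance ::
  "nat \<Rightarrow> nat \<Rightarrow> ('c :: finite point \<Rightarrow> nat) \<Rightarrow> 'c point measure \<Rightarrow> (nat \<Rightarrow> 'c) \<Rightarrow> nat set \<Rightarrow> real" where
  "decomposed_variance m1 m2 \<M> D a S =
     explained_variance m1 m2 \<M> D a S -
     (\<Sum>S' | finite S \<and> S' \<noteq> {} \<and> S' \<subset> S. decomposed_variance m1 m2 \<M> D a S')"
  by auto
termination
  by (relation "Wellfounded.measure (\<lambda>(m1, m2, \<M>, D, a, S). card S)") (auto intro: psubset_card_mono)

declare decomposed_variance.simps [simp del]

definition fif ::
  "nat \<Rightarrow> nat \<Rightarrow> ('c :: finite point \<Rightarrow> nat) \<Rightarrow> 'c point measure \<Rightarrow> (nat \<Rightarrow> 'c) \<Rightarrow> (nat \<Rightarrow> 'c) \<Rightarrow> nat set \<Rightarrow> real" where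
  "fif m1 m2 \<M> D a_max a_min S =
     decomposed_variance m1 m2 \<M> D a_max S / group_prob \<M> D 0 a_max -
     decomposed_variance m1 m2 \<M> D a_min S / group_prob \<M> D 0 a_min"

end

theory Submission
  imports Defs
begin

text \<open>
  By definition the \<open>V\<^sub>a\<^sub>,\<^sub>S'\<close> with \<open>S' \<subseteq> S\<close> sum up to the explained variance of \<open>S\<close>. All features
  together generate the full sigma-algebra, so for \<open>S = [m]\<close> this is the variance \<open>p (1 - p)\<close> of the
  prediction, with \<open>p\<close> the probability of a positive prediction in the group; dividing by \<open>1 - p\<close>
  leaves \<open>p\<close>. The sums in (b) and (c) are differences of sums over all non-empty subsets of two sets,
  so the hypothesis for the largest \<open>S\<close> suffices. This \<open>S\<close> is empty only if \<open>m = 2\<close> in (b) or \<open>m = 1\<close>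
  in (c). As \<open>m1 = m2 = 1\<close> is excluded in (b), all influences then vanish: there is only one group if
  \<open>m2 = 0\<close>, and each group consists of a single data point if \<open>m1 = 0\<close>.
\<close>

section \<open>Sums over families of subsets\<close>

lemma sum_powerset_insert:
  fixes f :: "'a set \<Rightarrow> 'b :: ab_group_add"
  assumes "finite T" "i \<notin> T"
  shows "(\<Sum>S | S \<subseteq> T. f (S \<union> {i})) =
    (\<Sum>S | S \<noteq> {} \<and> S \<subseteq> T \<union> {i}. f S) - (\<Sum>S | S \<noteq> {} \<and> S \<subseteq> T. f S)"
proof -
  \<comment> \<open>A subset of \<open>T \<union> {i}\<close> either avoids \<open>i\<close> or
    comes from a unique \<open>S \<subseteq> T\<close> by adding \<open>i\<close>. The empty
    \<open>S\<close> yields \<open>{i}\<close>, so only the first family has to exclude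
    \<open>{}\<close>.\<close>
  have eq: "{S. S \<noteq> {} \<and> S \<subseteq> T \<union> {i}} = {S. S \<noteq> {} \<and> S \<subseteq> T} \<union> (\<lambda>S. S \<union> {i}) ` {S. S \<subseteq> T}"
  proof (intro equalityI subsetI)
    fix S assume S: "S \<in> {S. S \<noteq> {} \<and> S \<subseteq> T \<union> {i}}"
    show "S \<in> {S. S \<noteq> {} \<and> S \<subseteq> T} \<union> (\<lambda>S. S \<union> {i}) ` {S. S \<subseteq> T}"
    proof (cases "i \<in> S")
      case True
      then have "S = (S - {i}) \<union> {i}" "S - {i} \<subseteq> T" using S by auto
      then show ?thesis by blast
    qed (use S in auto)
  qed auto
  have inj: "inj_on (\<lambda>S. S \<union> {i}) {S. S \<subseteq> T}"
    using assms(2) by (auto simp: inj_on_def)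
  have "(\<Sum>S | S \<noteq> {} \<and> S \<subseteq> T \<union> {i}. f S) =
      (\<Sum>S | S \<noteq> {} \<and> S \<subseteq> T. f S) + sum f ((\<lambda>S. S \<union> {i}) ` {S. S \<subseteq> T})"
    unfolding eq using assms by (intro sum.union_disjoint) auto
  also have "sum f ((\<lambda>S. S \<union> {i}) ` {S. S \<subseteq> T}) = (\<Sum>S | S \<subseteq> T. f (S \<union> {i}))"
    by (simp only: sum.reindex[OF inj] comp_def)
  finally show ?thesis by simp
qed

text \<open>This is the recursion with its sum moved to the other side; \<open>S \<noteq> {}\<close>
  makes \<open>S\<close> itself one of the summands.\<close>

lemma sum_decomposed_variance:
  assumes "finite S" "S \<noteq> {}"
  shows "(\<Sum>S' | S' \<noteq> {} \<and> S' \<subseteq> S. decomposed_variance m1 m2 \<M> D a S') =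
    explained_variance m1 m2 \<M> D a S"
proof -
  have eq: "{S'. S' \<noteq> {} \<and> S' \<subseteq> S} = insert S {S'. finite S \<and> S' \<noteq> {} \<and> S' \<subset> S}"
    using assms by auto
  have "finite {S'. finite S \<and> S' \<noteq> {} \<and> S' \<subset> S}"
    using assms by (auto intro: finite_subset[of _ "Pow S"])
  then have "(\<Sum>S' | S' \<noteq> {} \<and> S' \<subseteq> S. decomposed_variance m1 m2 \<M> D a S') =
    decomposed_variance m1 m2 \<M> D a S +
      (\<Sum>S' | finite S \<and> S' \<noteq> {} \<and> S' \<subset> S. decomposed_variance m1 m2 \<M> D a S')"
    unfolding eq by (subst sum.insert) auto
  then show ?thesis
    by (subst (asm) decomposed_variance.simps[of _ _ _ _ _ S]) simp
qed

section \<open>The sigma-algebra generated by all features\<close>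

lemma sets_features_algebra_all:
  "sets (features_algebra m1 m2 {1..m1 + m2} :: ('c :: finite) point measure) =
    sets (feature_space m1 m2)" (is "sets ?F = sets ?N")
proof
  have sub: "sets (feature_algebra m1 m2 i) \<subseteq> sets ?N" if "i \<in> {1..m1 + m2}" for i
  proof (cases "i \<le> m1")
    case True
    then have "i \<in> {1..m1}" using that by auto
    then have "(\<lambda>z. fst z i) \<in> measurable ?N borel"
      unfolding feature_space_def by measurable
    then show ?thesis
      using True by (auto simp: feature_algebra_def sets_vimage_algebra2 dest: measurable_sets)
  next
    case False
    then have "i - m1 \<in> {1..m2}" using that by auto
    then have "(\<lambda>z. snd z (i - m1)) \<in> measurable ?N (count_space UNIV)"
      unfolding feature_space_def by measurable
    then show ?thesis
      using False by (auto simp: feature_algebra_def sets_vimage_algebra2 dest: measurable_sets)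
  qed
  have Pow: "(\<Union>i\<in>{1..m1 + m2}. sets (feature_algebra m1 m2 i)) \<subseteq> Pow (space ?N)"
    using sub sets.sets_into_space by blast
  have sets_F: "sets ?F = sigma_sets (space ?N) (\<Union>i\<in>{1..m1 + m2}. sets (feature_algebra m1 m2 i))"
    unfolding features_algebra_def using Pow by (simp add: sets_measure_of)
  have space_F: "space ?F = space ?N"
    unfolding features_algebra_def using Pow by (simp add: space_measure_of)
  show "sets ?F \<subseteq> sets ?N"
    unfolding sets_F by (intro sets.sigma_sets_subset UN_least sub)
  have gen: "A \<in> sets ?F" if "i \<in> {1..m1 + m2}" "A \<in> sets (feature_algebra m1 m2 i)" for A i
    unfolding sets_F using that by blast
  have fst_m: "(\<lambda>z. fst z i) \<in> measurable ?F borel" if "i \<in> {1..m1}" for i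
  proof (rule measurableI)
    fix B :: "real set" assume "B \<in> sets borel"
    then have "(\<lambda>z. fst z i) -` B \<inter> space ?N \<in> sets (feature_algebra m1 m2 i :: 'c point measure)"
      using that by (simp add: feature_algebra_def in_vimage_algebra)
    then show "(\<lambda>z. fst z i) -` B \<inter> space ?F \<in> sets ?F"
      unfolding space_F using that by (intro gen[of i]) auto
  qed simp
  have snd_m: "(\<lambda>z. snd z j) \<in> measurable ?F (count_space UNIV)" if "j \<in> {1..m2}" for j
  proof (rule measurableI)
    fix B :: "'c set"
    \<comment> \<open>The index is kept unsimplified to match \<open>snd z (i - m1)\<close> in
      \<open>feature_algebra_def\<close> at \<open>i = j + m1\<close>; \<open>j \<ge> 1\<close>
      selects the second branch there.\<close>
    have "(\<lambda>z. snd z (j + m1 - m1)) -` B \<inter> space ?N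
        \<in> sets (feature_algebra m1 m2 (j + m1) :: 'c point measure)"
      using that by (simp add: feature_algebra_def in_vimage_algebra del: add_diff_cancel_right')
    then show "(\<lambda>z. snd z j) -` B \<inter> space ?F \<in> sets ?F"
      unfolding space_F using that by (intro gen[of "j + m1"]) auto
  qed simp
  \<comment> \<open>Measurability into a product needs, besides measurable coordinates, that the
    values are \<open>undefined\<close> off the index set.\<close>
  have coordinates: "fst z \<in> {1..m1} \<rightarrow>\<^sub>E UNIV" "snd z \<in> {1..m2} \<rightarrow>\<^sub>E UNIV" if "z \<in> space ?F" for z
    using that unfolding space_F feature_space_def by (auto simp: space_pair_measure space_PiM)
  \<comment> \<open>As both spaces coincide, measurability of the identity is exactly the inclusion
    \<open>sets ?N \<subseteq> sets ?F\<close>, and it can be checked coordinate by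
    coordinate.\<close>
  have id_m: "(\<lambda>z. z) \<in> measurable ?F ?N"
    unfolding feature_space_def
  proof (rule measurable_pair)
    show "fst \<circ> (\<lambda>z. z) \<in> measurable ?F (\<Pi>\<^sub>M i\<in>{1..m1}. borel)"
      using fst_m coordinates(1) unfolding comp_def by (intro measurable_PiM_single') auto
    show "snd \<circ> (\<lambda>z. z) \<in> measurable ?F (\<Pi>\<^sub>M j\<in>{1..m2}. count_space UNIV)"
      using snd_m coordinates(2) unfolding comp_def by (intro measurable_PiM_single') auto
  qed
  show "sets ?N \<subseteq> sets ?F"
  proof
    fix A assume A: "A \<in> sets ?N"
    then have "(\<lambda>z. z) -` A \<inter> space ?F = A"
      using sets.sets_into_space space_F by blast
    then show "A \<in> sets ?F"
      using measurable_sets[OF id_m A] by simp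
  qed
qed

section \<open>Variances of constants and indicators\<close>

lemma (in prob_space) variance_AE_const:
  fixes X :: "'a \<Rightarrow> real"
  assumes "X \<in> borel_measurable M" "AE x in M. X x = c"
  shows "variance X = 0"
proof -
  note [measurable] = assms(1)
  have "expectation X = expectation (\<lambda>_. c)"
    using assms(2) by (intro integral_cong_AE) auto
  then have "expectation X = c" by (simp add: prob_space)
  then have "variance X = expectation (\<lambda>_. 0 :: real)"
    using assms(2) by (intro integral_cong_AE) auto
  then show ?thesis by simp
qed

lemma (in prob_space) variance_indicator:
  assumes "A \<in> events"
  shows "variance (indicat_real A) = prob A * (1 - prob A)"
proof -
  have sq: "(\<lambda>x. (indicat_real A x)\<^sup>2) = indicat_real A"
    by (auto simp: indicator_def)
  have "variance (indicat_real A) = expectation (\<lambda>x. (indicat_real A x)\<^sup>2) - (expectation (indicat_real A))\<^sup>2"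
    using assms by (intro variance_eq) (simp_all add: sq integrable_real_indicator emeasure_eq_measure)
  then show ?thesis
    using assms by (simp add: sq right_diff_distrib flip: power2_eq_square)
qed

section \<open>Conditional distributions on the sensitive groups\<close>

locale classified_population =
  fixes m1 m2 :: nat and D :: "('c :: finite) point measure" and \<M> :: "'c point \<Rightarrow> nat"
  assumes prob_D: "prob_space D"
    and sets_D: "sets D = sets (feature_space m1 m2)"
    and classifier: "\<M> \<in> measurable (feature_space m1 m2) (count_space {0, 1})"
begin

sublocale prob_space D by (fact prob_D)

lemma space_D: "space D = space (feature_space m1 m2)"
  by (rule sets_eq_imp_space_eq[OF sets_D])

text \<open>A group of positive probability contains a data point, whose sensitive part is
  extensional. Hence there are finitely many groups, and at most one if
  \<open>m2 = 0\<close>.\<close>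

lemma sensitive_groups_subset:
  "sensitive_groups D \<subseteq> {1..m2} \<rightarrow>\<^sub>E UNIV"
proof
  fix a assume "a \<in> sensitive_groups D"
  then have "{z \<in> space D. snd z = a} \<noteq> {}"
    unfolding sensitive_groups_def by (metis (lifting) less_irrefl measure_empty mem_Collect_eq)
  then show "a \<in> {1..m2} \<rightarrow>\<^sub>E UNIV"
    by (auto simp: space_D feature_space_def space_pair_measure space_PiM)
qed

lemma finite_sensitive_groups: "finite (sensitive_groups D)"
  using sensitive_groups_subset by (rule finite_subset) (auto intro: finite_PiE)

context
  fixes a
  assumes a: "a \<in> sensitive_groups D"
begin

lemma group_event:
  "{z \<in> space D. snd z = a} \<in> events" "prob {z \<in> space D. snd z = a} > 0"
proof -
  show "prob {z \<in> space D. snd z = a} > 0"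
    using a by (simp add: sensitive_groups_def)
  \<comment> \<open>\<open>measure\<close> is 0 by default on non-measurable sets, so positive
    measure already forces measurability.\<close>
  then show "{z \<in> space D. snd z = a} \<in> events"
    using measure_notin_sets by fastforce
qed

lemma prob_space_group_law: "prob_space (group_law D a)"
  unfolding group_law_def
  using group_event by (intro prob_space_uniform_measure) (auto simp: emeasure_eq_measure)

lemma sets_group_law: "sets (group_law D a) = sets (feature_space m1 m2)"
  by (simp add: group_law_def sets_D)

lemma space_group_law: "space (group_law D a) = space (feature_space m1 m2)"
  by (rule sets_eq_imp_space_eq[OF sets_group_law])

lemma prediction_event: "{z \<in> space D. \<M> z = y} \<in> events"
proof (cases "y \<in> {0, 1}")
  case True
  have "\<M> -` {y} \<inter> space (feature_space m1 m2) \<in> sets (feature_space m1 m2)"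
    using classifier True by (intro measurable_sets) auto
  also have "\<M> -` {y} \<inter> space (feature_space m1 m2) = {z \<in> space D. \<M> z = y}"
    by (auto simp: space_D)
  finally show ?thesis by (simp add: sets_D)
next
  case False
  then have "{z \<in> space D. \<M> z = y} = {}"
    using measurable_space[OF classifier] unfolding space_D space_count_space by blast
  then show ?thesis by (simp only: sets.empty_sets)
qed

lemma group_prob_eq: "group_prob \<M> D y a = measure (group_law D a) {z \<in> space D. \<M> z = y}"
proof -
  have "measure (group_law D a) {z \<in> space D. \<M> z = y} =
      prob ({z \<in> space D. snd z = a} \<inter> {z \<in> space D. \<M> z = y}) / prob {z \<in> space D. snd z = a}"
    unfolding group_law_def
    using group_event prediction_event by (intro measure_uniform_measure) (auto simp: emeasure_eq_measure)
  also have "{z \<in> space D. snd z = a} \<inter> {z \<in> space D. \<M> z = y} = {z \<in> space D. \<M> z = y \<and> snd z = a}"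
    by auto
  finally show ?thesis by (simp add: group_prob_def cond_prob_def)
qed

lemma group_prob_0: "group_prob \<M> D 0 a = 1 - group_prob \<M> D 1 a"
proof -
  interpret G: prob_space "group_law D a" by (rule prob_space_group_law)
  have "{z \<in> space D. \<M> z = 0} = space (group_law D a) - {z \<in> space D. \<M> z = 1}"
    using measurable_space[OF classifier] by (auto simp: space_D space_group_law)
  then show ?thesis
    unfolding group_prob_eq
    using prediction_event[of 1] by (simp add: G.prob_compl sets_group_law sets_D)
qed

lemma explained_variance_all:
  "explained_variance m1 m2 \<M> D a {1..m1 + m2} = group_prob \<M> D 1 a * group_prob \<M> D 0 a"
proof -
  let ?G = "group_law D a" and ?F = "features_algebra m1 m2 {1..m1 + m2} :: 'c point measure"
  let ?f = "indicator {z. \<M> z = 1} :: 'c point \<Rightarrow> real"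
  let ?A = "{z \<in> space D. \<M> z = 1}"
  interpret G: prob_space ?G by (rule prob_space_group_law)
  have sets_F: "sets ?F = sets ?G"
    by (simp only: sets_features_algebra_all sets_group_law)
  then have space_F: "space ?F = space ?G" by (rule sets_eq_imp_space_eq)
  interpret finite_measure_subalgebra ?G ?F
    by unfold_locales (simp only: subalgebra_def sets_F space_F subset_refl simp_thms)
  have A: "?A \<in> sets ?G"
    using prediction_event by (simp add: sets_group_law sets_D)
  \<comment> \<open>\<open>?f\<close> is the indicator of a subset of the whole type; on the space
    it agrees with that of the event \<open>?A\<close>.\<close>
  have eq: "?f z = indicator ?A z" if "z \<in> space ?G" for z
    using that by (auto simp: indicator_def space_D space_group_law)
  have f: "?f \<in> borel_measurable ?G"
    using A by (subst measurable_cong[OF eq]) auto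
  have "integrable ?G ?f"
    using A
    by (subst Bochner_Integration.integrable_cong[OF refl eq])
      (auto intro: integrable_real_indicator simp: G.emeasure_eq_measure)
  moreover have "?f \<in> borel_measurable ?F"
    using f measurable_cong_sets[OF sets_F] by blast
  \<comment> \<open>The sigma-algebra conditioned on is the full one, so the indicator is its own
    conditional expectation.\<close>
  ultimately have ae: "AE z in ?G. real_cond_exp ?G ?F ?f z = ?f z"
    by (rule real_cond_exp_F_meas)
  have ae': "AE z in ?G. real_cond_exp ?G ?F ?f z = indicator ?A z"
    using ae AE_space by eventually_elim (simp only: eq)
  \<comment> \<open>The variance contains the mean, so the means are matched before the squared
    deviations.\<close>
  have "G.expectation (real_cond_exp ?G ?F ?f) = G.expectation (indicator ?A)"
    using ae' A by (intro integral_cong_AE) auto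
  then have "G.variance (real_cond_exp ?G ?F ?f) = G.variance (indicator ?A)"
    using ae' A by (intro integral_cong_AE) auto
  also have "\<dots> = G.prob ?A * (1 - G.prob ?A)"
    using A by (rule G.variance_indicator)
  finally show ?thesis
    by (simp add: explained_variance_def group_prob_0) (simp add: group_prob_eq)
qed

text \<open>The law of the group is concentrated on one point, since
  \<open>\<lambda>_. undefined\<close> is the only element of the empty product. Every random
  variable is then almost surely constant, whatever \<open>S\<close> is.\<close>

lemma explained_variance_no_nonsensitive:
  assumes "m1 = 0"
  shows "explained_variance m1 m2 \<M> D a S = 0"
proof -
  let ?X = "real_cond_exp (group_law D a) (features_algebra m1 m2 S) (indicator {z. \<M> z = 1})"
  have "AE z in group_law D a. z = (\<lambda>_. undefined, a)"
    unfolding group_law_def using group_event assms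
    by (intro AE_uniform_measureI AE_I2)
      (auto simp: space_D feature_space_def space_pair_measure space_PiM)
  then have "AE z in group_law D a. ?X z = ?X (\<lambda>_. undefined, a)"
    by eventually_elim simp
  then show ?thesis
    unfolding explained_variance_def
    by (intro prob_space.variance_AE_const[OF prob_space_group_law] borel_measurable_cond_exp2)
qed

lemma decomposed_variance_no_nonsensitive:
  assumes "m1 = 0" "finite S"
  shows "decomposed_variance m1 m2 \<M> D a S = 0"
  using assms(2)
proof (induction rule: finite_psubset_induct)
  case (psubset S)
  then show ?case
    by (subst decomposed_variance.simps)
      (simp add: explained_variance_no_nonsensitive[OF assms(1)])
qed

end

section \<open>Influences and statistical parity\<close>

lemma fif_degenerate:
  assumes "a_max \<in> sensitive_groups D" "a_min \<in> sensitive_groups D" "m1 = 0 \<or> m2 = 0" "finite S"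
  shows "fif m1 m2 \<M> D a_max a_min S = 0"
  using assms(3)
proof
  assume "m1 = 0"
  then show ?thesis
    unfolding fif_def
    using decomposed_variance_no_nonsensitive[OF assms(1) _ assms(4)]
      decomposed_variance_no_nonsensitive[OF assms(2) _ assms(4)] by simp
next
  assume "m2 = 0"
  \<comment> \<open>Without sensitive features, both groups are the unique extensional function on
    the empty index set, so the two fractions in \<open>fif\<close> cancel.\<close>
  then have "a_max = a_min"
    using sensitive_groups_subset assms(1,2) by (auto simp: PiE_def)
  then show ?thesis by (simp add: fif_def)
qed

lemma sum_fif:
  assumes "a_max \<in> sensitive_groups D" "a_min \<in> sensitive_groups D"
    and "group_prob \<M> D 0 a_max \<noteq> 0" "group_prob \<M> D 0 a_min \<noteq> 0"
  shows "(\<Sum>S | S \<noteq> {} \<and> S \<subseteq> {1..m1 + m2}. fif m1 m2 \<M> D a_max a_min S) =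
    group_prob \<M> D 1 a_max - group_prob \<M> D 1 a_min"
\<comment> \<open>Without features the left sum is empty and \<open>sum_decomposed_variance\<close>
  does not apply; the right side vanishes because the two groups coincide.\<close>
proof (cases "m1 + m2 = 0")
  case True
  then have "a_max = a_min"
    using sensitive_groups_subset assms(1,2) by (auto simp: PiE_def)
  then show ?thesis by (simp add: fif_def)
next
  case False
  then have ne: "{1..m1 + m2} \<noteq> {}" by auto
  have "(\<Sum>S | S \<noteq> {} \<and> S \<subseteq> {1..m1 + m2}. fif m1 m2 \<M> D a_max a_min S) =
      explained_variance m1 m2 \<M> D a_max {1..m1 + m2} / group_prob \<M> D 0 a_max -
      explained_variance m1 m2 \<M> D a_min {1..m1 + m2} / group_prob \<M> D 0 a_min"
    unfolding fif_def sum_subtractf sum_divide_distrib[symmetric]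
    by (simp only: sum_decomposed_variance[OF finite_atLeastAtMost ne])
  then show ?thesis
    unfolding explained_variance_all[OF assms(1)] explained_variance_all[OF assms(2)]
    using assms(3,4) by simp
qed

lemma statistical_parity_eq:
  assumes "is_arg_max (group_prob \<M> D 1) (\<lambda>a. a \<in> sensitive_groups D) a_max"
    and "is_arg_min (group_prob \<M> D 1) (\<lambda>a. a \<in> sensitive_groups D) a_min"
  shows "statistical_parity \<M> D = group_prob \<M> D 1 a_max - group_prob \<M> D 1 a_min"
proof -
  have "Max (group_prob \<M> D 1 ` sensitive_groups D) = group_prob \<M> D 1 a_max"
    using assms(1) finite_sensitive_groups by (intro Max_eqI) (auto simp: is_arg_max_linorder)
  moreover have "Min (group_prob \<M> D 1 ` sensitive_groups D) = group_prob \<M> D 1 a_min"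
    using assms(2) finite_sensitive_groups by (intro Min_eqI) (auto simp: is_arg_min_linorder)
  ultimately show ?thesis by (simp add: statistical_parity_def)
qed

end

theorem theorem2:
  fixes m1 m2 m :: nat
    and D :: "('c :: finite) point measure"
    and \<M> :: "'c point \<Rightarrow> nat"
    and a_max a_min :: "nat \<Rightarrow> 'c"
    and w :: "nat set \<Rightarrow> real"
  assumes m: "m = m1 + m2"
    and prob_D: "prob_space D"
    and sets_D: "sets D = sets (feature_space m1 m2)"
    and classifier: "\<M> \<in> measurable (feature_space m1 m2) (count_space {0, 1})"
    and a_max: "is_arg_max (group_prob \<M> D 1) (\<lambda>a. a \<in> sensitive_groups D) a_max"
    and a_min: "is_arg_min (group_prob \<M> D 1) (\<lambda>a. a \<in> sensitive_groups D) a_min"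
    and nonzero_max: "group_prob \<M> D 0 a_max \<noteq> 0"
    and nonzero_min: "group_prob \<M> D 0 a_min \<noteq> 0"
    and w: "w = fif m1 m2 \<M> D a_max a_min"
  shows "(\<Sum>S | S \<noteq> {} \<and> S \<subseteq> {1..m}. w S) = statistical_parity \<M> D
    \<and> (\<not> (m1 = 1 \<and> m2 = 1) \<longrightarrow>
        (\<forall>i\<in>{1..m}. \<forall>j\<in>{1..m}. i \<noteq> j \<longrightarrow>
          (\<forall>S. S \<noteq> {} \<and> S \<subseteq> {1..m} \<and> i \<notin> S \<and> j \<notin> S \<longrightarrow>
             (\<Sum>S' | S' \<noteq> {} \<and> S' \<subseteq> S \<union> {i}. w S') = (\<Sum>S' | S' \<noteq> {} \<and> S' \<subseteq> S \<union> {j}. w S')) \<longrightarrow>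
          (\<Sum>S'' | S'' \<subseteq> {1..m} - {i, j}. w (S'' \<union> {i})) =
          (\<Sum>S'' | S'' \<subseteq> {1..m} - {i, j}. w (S'' \<union> {j}))))
    \<and> (\<forall>i\<in>{1..m}.
          (\<forall>S. S \<noteq> {} \<and> S \<subseteq> {1..m} \<and> i \<notin> S \<longrightarrow>
             (\<Sum>S' | S' \<noteq> {} \<and> S' \<subseteq> S \<union> {i}. w S') = (\<Sum>S' | S' \<noteq> {} \<and> S' \<subseteq> S. w S')) \<longrightarrow>
          (\<Sum>S'' | S'' \<subseteq> {1..m} - {i}. w (S'' \<union> {i})) = 0)"
proof -
  interpret classified_population m1 m2 D \<M>
    using prob_D sets_D classifier by (rule classified_population.intro)
  have groups: "a_max \<in> sensitive_groups D" "a_min \<in> sensitive_groups D"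
    using a_max a_min by (auto simp: is_arg_max_def is_arg_min_def)
  have degenerate: "w S = 0" if "m1 = 0 \<or> m2 = 0" "finite S" for S
    using fif_degenerate[OF groups that] by (simp add: w)
  \<comment> \<open>In terms of \<open>g\<close>, the hypotheses of (b) and (c) read
    \<open>g (S \<union> {i}) = g (S \<union> {j})\<close> and
    \<open>g (S \<union> {i}) = g S\<close>. In (b) the same \<open>g T\<close> is subtracted on
    both sides of the conclusion.\<close>
  define g where "g T = (\<Sum>S | S \<noteq> {} \<and> S \<subseteq> T. w S)" for T
  have insert: "(\<Sum>S | S \<subseteq> T. w (S \<union> {i})) = g (T \<union> {i}) - g T" if "finite T" "i \<notin> T" for T i
    unfolding g_def using that by (rule sum_powerset_insert)
  have decomposability: "g {1..m} = statistical_parity \<M> D"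
    unfolding g_def w m statistical_parity_eq[OF a_max a_min]
    using groups nonzero_max nonzero_min by (rule sum_fif)
  have symmetry: "(\<Sum>S | S \<subseteq> {1..m} - {i, j}. w (S \<union> {i})) = (\<Sum>S | S \<subseteq> {1..m} - {i, j}. w (S \<union> {j}))"
    if mixed: "\<not> (m1 = 1 \<and> m2 = 1)" and ij: "i \<in> {1..m}" "j \<in> {1..m}" "i \<noteq> j"
      and hyp: "\<forall>S. S \<noteq> {} \<and> S \<subseteq> {1..m} \<and> i \<notin> S \<and> j \<notin> S \<longrightarrow> g (S \<union> {i}) = g (S \<union> {j})" for i j
  proof (cases "{1..m} - {i, j} = {}")
    case True
    then have "{1..m} = {i, j}" using ij by blast
    then have "card {1..m} = 2" using ij by simp
    \<comment> \<open>No non-empty \<open>S\<close> avoids both features here, so \<open>hyp\<close>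
      is vacuous. For \<open>m1 = m2 = 1\<close> the conclusion can fail: within a group the
      non-sensitive feature determines the prediction and the sensitive one is constant, so their
      influences are the statistical parity and 0.\<close>
    then have "m1 = 0 \<or> m2 = 0" using mixed m by auto
    then show ?thesis unfolding True by (simp add: degenerate)
  next
    case False
    then have "g (({1..m} - {i, j}) \<union> {i}) = g (({1..m} - {i, j}) \<union> {j})"
      by (intro hyp[rule_format]) auto
    then show ?thesis
      using insert[of "{1..m} - {i, j}" i] insert[of "{1..m} - {i, j}" j] by simp
  qed
  have null: "(\<Sum>S | S \<subseteq> {1..m} - {i}. w (S \<union> {i})) = 0"
    if i: "i \<in> {1..m}"
      and hyp: "\<forall>S. S \<noteq> {} \<and> S \<subseteq> {1..m} \<and> i \<notin> S \<longrightarrow> g (S \<union> {i}) = g S" for i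
  proof (cases "{1..m} - {i} = {}")
    case True
    then have "{1..m} = {i}" using i by blast
    then have "card {1..m} = 1" by simp
    then have "m1 = 0 \<or> m2 = 0" using m by auto
    then show ?thesis unfolding True by (simp add: degenerate)
  next
    case False
    then have "g (({1..m} - {i}) \<union> {i}) = g ({1..m} - {i})"
      by (intro hyp[rule_format]) auto
    then show ?thesis
      using insert[of "{1..m} - {i}" i] by simp
  qed
  show ?thesis
    by (intro conjI impI ballI decomposability[unfolded g_def] symmetry[unfolded g_def] null[unfolded g_def])
qed

end
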